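(* In Situation 1 there exist infinitely many Nash equilibria. The Nash equilibria are exactly the vectors $(\hat\alpha,\hat\beta,\hat\gamma,\hat e,\hat m,\hat a)$ satisfying $$\hat\beta=\frac{v}{u+v},\quad \hat e=(\varphi')^{-1}\Big(\frac{u+v}{u}\Big),\quad \hat a=(\psi')^{-1}\Big(\frac{(u+v)(1+r_J)}{\delta^+u}\Big),\quad \hat\gamma=\frac1{g'(\hat m)},$$ $$\hat\alpha=C(\hat\beta)+(1+r_J)(D+\hat a)+\hat e-\frac{u}{u+v}\delta\psi(\hat a)-G(\hat m),$$ for $\hat m$ varying in $$\hat{\mathcal M}_1(r_J):=\Big[0,\;G^{-1}\Big(C(\hat\beta)+(1+r_J)(D+\hat a)+\hat e-\frac{u}{u+v}\delta\psi(\hat a)\Big)\Big].$$ The corresponding optimal values for firms $J$ and $I$ are respectively $V(0)$ and $$\hat I^1(\hat m)=b^a(\hat a)-e^{-u\delta\psi(\hat a)}\,e^{u(1+r_J)(D+\hat a)}\,B(\hat m).$$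
   Context: Standing assumptions. $u,v>0$, $U(x)=-e^{-ux}$, $V(x)=-e^{-vx}$; $D>0$, $r_J\ge 0$, $\delta\in\mathbb R$, $x^+=\max(x,0)$. $\mu$ is a non-constant real random variable bounded from below by a finite constant $\underline\mu$, with $\mathbb E[e^{\lambda\mu}]<\infty$ for all $\lambda\in\mathbb R$. $\varphi,\psi:\mathbb R_+\to\mathbb R_+$ are $C^1$, increasing, strictly concave, $\varphi'(0)=\psi'(0)=+\infty$, $\varphi'(\infty)=\psi'(\infty)=0$, $\varphi(\infty)+\delta^+\psi(\infty)<\underline\mu$, and $(\varphi')^{-1}(x)\sim(\psi')^{-1}(x)$ as $x\to0$. $g:\mathbb R_+\to\mathbb R$ is $C^1$, increasing, strictly concave, $g'(0)=\infty$, $g'(\infty)=0$, and $m_0:=\inf\{m>0:g(m)>0\}<\infty$. $b^a,b^m,b^e:\mathbb R_+\to\mathbb R_+$ are $C^1$, increasing, concave; $(b^a)'(0)>0$ (possibly infinite), $(b^a)'(\infty)=0$, $b^a(\infty)<\infty$; $(b^m)'(0)=(b^e)'(0)=\infty$, $(b^m)'(\infty)=(b^e)'(\infty)=0$. (A function with infinite derivative at $0$ is continuous on $\mathbb R_+$ and $C^1$ on $(0,\infty)$.) Conventions: $(\phi')^{-1}(+\infty)=0$ for $\phi=\varphi,\psi,g$; $x/0=+\infty$ for $x>0$; $1/g'(0)=0$, $g(0)/g'(0)=0$. Situation 1. Write $C^{op}=\mu-\varphi(e)-\delta\psi(a)$. Firm $J$ controls $(a,e,m)\in\mathbb R_+^3$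 and firm $I$ controls $(\alpha,\beta,\gamma)\in\mathbb R_+\times\mathbb R\times\mathbb R_+$. The payoffs are $$J^1=\mathbb E\big[V\big(\alpha+(\beta-1)C^{op}-e+\gamma g(m)-m-(1+r_J)(D+a)\big)\big],$$ $$I^1=\mathbb E\big[b^a(a)+U\big(b^m(m)+b^e(e)-\alpha-\beta C^{op}-\gamma g(m)\big)\big].$$ A Nash equilibrium is a vector $(\hat\alpha,\hat\beta,\hat\gamma,\hat e,\hat m,\hat a)$ such that $(\hat a,\hat e,\hat m)$ maximizes $J^1$ over $\mathbb R_+^3$ given $(\hat\alpha,\hat\beta,\hat\gamma)$, and $(\hat\alpha,\hat\beta,\hat\gamma)$ maximizes $I^1$ over the $(\alpha,\beta,\gamma)\in\mathbb R_+\times\mathbb R\times\mathbb R_+$ satisfying $J^1\ge V(0)$, given $(\hat a,\hat e,\hat m)$. Notation. $e^*(\beta)=(\varphi')^{-1}\big(\frac1{(1-\beta)^+}\big)$; $C(\beta)=\frac1v\ln\mathbb E\big[e^{v(1-\beta)(\mu-\varphi(e^*(\beta)))}\big]$; $G(m)=\frac{g(m)}{g'(m)}-m$, and $G^{-1}:[-m_0,\infty)\to[m_0,\infty)$ is the inverse of the increasing bijection $G|_{[m_0,\infty)}$; with $\mathrm{Id}$ the identity map, $$B(m)=e^{u(\mathrm{Id}-b^m)(m)}\,e^{u(\mathrm{Id}-b^e)(e^*(\frac v{u+v}))}\,e^{(u+v)C(\frac v{u+v})}.$$ *)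

theory Defs
  imports "HOL-Probability.Probability" "HOL-Library.Landau_Symbols"
begin

definition strictly_concave_on :: "real set \<Rightarrow> (real \<Rightarrow> real) \<Rightarrow> bool" where
  "strictly_concave_on S f \<longleftrightarrow> convex S \<and>
     (\<forall>x\<in>S. \<forall>y\<in>S. \<forall>t. x \<noteq> y \<and> 0 < t \<and> t < 1 \<longrightarrow>
        f ((1 - t) * x + t * y) > (1 - t) * f x + t * f y)"

text \<open>
  Functions on the half-line are total functions of which only the values on \<open>{0..}\<close> matter.
  Their derivative is the limit of difference quotients within \<open>{0..}\<close>, one-sided at \<open>0\<close> and
  taken in the extended reals, so that \<open>f'(0) = \<infinity>\<close> is an ordinary equation. With this choice
  the conventions \<open>1 / 0 = \<infinity>\<close>, \<open>1 / \<infinity> = 0\<close> and \<open>c / \<infinity> = 0\<close> are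
  those of extended real division, and \<open>(f')\<^sup>-\<^sup>1(\<infinity>) = 0\<close> is a consequence of \<open>f'(0) = \<infinity>\<close>.
\<close>

definition deriv_Rp :: "(real \<Rightarrow> real) \<Rightarrow> real \<Rightarrow> ereal" where
  "deriv_Rp f x = Lim (at x within {0..}) (\<lambda>y. ereal ((f y - f x) / (y - x)))"

text \<open>Continuously differentiable on \<open>{0..}\<close>; if the derivative at \<open>0\<close> is infinite, this means
  continuous on \<open>{0..}\<close> and continuously differentiable on \<open>{0<..}\<close>.\<close>

definition C1_Rp :: "(real \<Rightarrow> real) \<Rightarrow> bool" where
  "C1_Rp f \<longleftrightarrow> continuous_on {0..} f \<and>
     (\<forall>x\<ge>0. ((\<lambda>y. ereal ((f y - f x) / (y - x))) \<longlongrightarrow> deriv_Rp f x) (at x within {0..})) \<and>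
     (\<forall>x>0. \<bar>deriv_Rp f x\<bar> \<noteq> \<infinity>) \<and>
     continuous_on {x. 0 \<le> x \<and> \<bar>deriv_Rp f x\<bar> \<noteq> \<infinity>} (deriv_Rp f)"

definition value_at_infinity :: "(real \<Rightarrow> real) \<Rightarrow> ereal" where
  "value_at_infinity f = Lim at_top (\<lambda>x. ereal (f x))"

definition inv_deriv_Rp :: "(real \<Rightarrow> real) \<Rightarrow> ereal \<Rightarrow> real" where
  "inv_deriv_Rp f = the_inv_into {0..} (deriv_Rp f)"

definition exp_utility :: "real \<Rightarrow> real \<Rightarrow> real" where
  "exp_utility k x = - exp (- k * x)"

definition op_cost ::
  "(real \<Rightarrow> real) \<Rightarrow> (real \<Rightarrow> real) \<Rightarrow> real \<Rightarrow> real \<Rightarrow> real \<Rightarrow> real \<Rightarrow> real" where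
  "op_cost \<phi> \<psi> \<delta> a e x = x - \<phi> e - \<delta> * \<psi> a"

definition payoff_J ::
  "'w measure \<Rightarrow> ('w \<Rightarrow> real) \<Rightarrow> (real \<Rightarrow> real) \<Rightarrow> (real \<Rightarrow> real) \<Rightarrow> (real \<Rightarrow> real) \<Rightarrow>
   real \<Rightarrow> real \<Rightarrow> real \<Rightarrow> real \<Rightarrow>
   real \<Rightarrow> real \<Rightarrow> real \<Rightarrow> real \<Rightarrow> real \<Rightarrow> real \<Rightarrow> real" where
  "payoff_J M \<mu> \<phi> \<psi> g v \<delta> D r \<alpha> \<beta> \<gamma> a e m =
     (\<integral>\<omega>. exp_utility v (\<alpha> + (\<beta> - 1) * op_cost \<phi> \<psi> \<delta> a e (\<mu> \<omega>) - e + \<gamma> * g m - m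
                        - (1 + r) * (D + a)) \<partial>M)"

definition payoff_I ::
  "'w measure \<Rightarrow> ('w \<Rightarrow> real) \<Rightarrow> (real \<Rightarrow> real) \<Rightarrow> (real \<Rightarrow> real) \<Rightarrow> (real \<Rightarrow> real) \<Rightarrow>
   (real \<Rightarrow> real) \<Rightarrow> (real \<Rightarrow> real) \<Rightarrow> (real \<Rightarrow> real) \<Rightarrow> real \<Rightarrow> real \<Rightarrow>
   real \<Rightarrow> real \<Rightarrow> real \<Rightarrow> real \<Rightarrow> real \<Rightarrow> real \<Rightarrow> real" where
  "payoff_I M \<mu> \<phi> \<psi> g ba bm be u \<delta> \<alpha> \<beta> \<gamma> a e m =
     (\<integral>\<omega>. ba a + exp_utility u (bm m + be e - \<alpha> - \<beta> * op_cost \<phi> \<psi> \<delta> a e (\<mu> \<omega>)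
                                - \<gamma> * g m) \<partial>M)"

definition nash ::
  "'w measure \<Rightarrow> ('w \<Rightarrow> real) \<Rightarrow> (real \<Rightarrow> real) \<Rightarrow> (real \<Rightarrow> real) \<Rightarrow> (real \<Rightarrow> real) \<Rightarrow>
   (real \<Rightarrow> real) \<Rightarrow> (real \<Rightarrow> real) \<Rightarrow> (real \<Rightarrow> real) \<Rightarrow>
   real \<Rightarrow> real \<Rightarrow> real \<Rightarrow> real \<Rightarrow> real \<Rightarrow>
   real \<Rightarrow> real \<Rightarrow> real \<Rightarrow> real \<Rightarrow> real \<Rightarrow> real \<Rightarrow> bool" where
  "nash M \<mu> \<phi> \<psi> g ba bm be u v \<delta> D r \<alpha> \<beta> \<gamma> e m a \<longleftrightarrow>
     (let J = payoff_J M \<mu> \<phi> \<psi> g v \<delta> D r; I = payoff_I M \<mu> \<phi> \<psi> g ba bm be u \<delta> in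
      0 \<le> a \<and> 0 \<le> e \<and> 0 \<le> m \<and>
      (\<forall>a'\<ge>0. \<forall>e'\<ge>0. \<forall>m'\<ge>0. J \<alpha> \<beta> \<gamma> a' e' m' \<le> J \<alpha> \<beta> \<gamma> a e m) \<and>
      0 \<le> \<alpha> \<and> 0 \<le> \<gamma> \<and> exp_utility v 0 \<le> J \<alpha> \<beta> \<gamma> a e m \<and>
      (\<forall>\<alpha>'\<ge>0. \<forall>\<beta>'. \<forall>\<gamma>'\<ge>0. exp_utility v 0 \<le> J \<alpha>' \<beta>' \<gamma>' a e m \<longrightarrow>
         I \<alpha>' \<beta>' \<gamma>' a e m \<le> I \<alpha> \<beta> \<gamma> a e m))"

definition e_star :: "(real \<Rightarrow> real) \<Rightarrow> real \<Rightarrow> real" where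
  "e_star \<phi> \<beta> = inv_deriv_Rp \<phi> (1 / ereal (max (1 - \<beta>) 0))"

definition C_fun :: "'w measure \<Rightarrow> ('w \<Rightarrow> real) \<Rightarrow> (real \<Rightarrow> real) \<Rightarrow> real \<Rightarrow> real \<Rightarrow> real" where
  "C_fun M \<mu> \<phi> v \<beta> =
     1 / v * ln (\<integral>\<omega>. exp (v * (1 - \<beta>) * (\<mu> \<omega> - \<phi> (e_star \<phi> \<beta>))) \<partial>M)"

definition m_zero :: "(real \<Rightarrow> real) \<Rightarrow> real" where
  "m_zero g = Inf {m. m > 0 \<and> g m > 0}"

definition G_fun :: "(real \<Rightarrow> real) \<Rightarrow> real \<Rightarrow> real" where
  "G_fun g m = real_of_ereal (ereal (g m) / deriv_Rp g m) - m"

definition G_inv :: "(real \<Rightarrow> real) \<Rightarrow> real \<Rightarrow> real" where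
  "G_inv g = the_inv_into {m_zero g..} (G_fun g)"

definition B_fun ::
  "'w measure \<Rightarrow> ('w \<Rightarrow> real) \<Rightarrow> (real \<Rightarrow> real) \<Rightarrow> (real \<Rightarrow> real) \<Rightarrow> (real \<Rightarrow> real) \<Rightarrow>
   real \<Rightarrow> real \<Rightarrow> real \<Rightarrow> real" where
  "B_fun M \<mu> \<phi> bm be u v m =
     exp (u * (m - bm m)) *
     exp (u * (e_star \<phi> (v / (u + v)) - be (e_star \<phi> (v / (u + v))))) *
     exp ((u + v) * C_fun M \<mu> \<phi> v (v / (u + v)))"

end

theory Submission
  imports Defs
begin

text \<open>
  Taking expectations turns both payoffs into exponentials of deterministic certainty equivalents
  built from the cumulant generating function \<open>cgf\<close> of \<open>\<mu>\<close>. Firm I only cares about the transfer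
  \<open>s = \<alpha> + \<gamma> g(m)\<close> and about \<open>\<beta>\<close>; making participation binding, its cost is, up to a constant,
  \<open>cgf (u \<beta>) / u + cgf (v (1 - \<beta>)) / v\<close>, whose unique minimum \<open>\<beta> = v / (u + v)\<close> comes from strict
  convexity of \<open>cgf\<close>. The bound on \<open>\<phi>\<close> and \<open>\<psi>\<close> makes the binding transfer positive for this \<open>\<beta>\<close>,
  so the sign constraints on \<open>\<alpha>\<close> and \<open>\<gamma>\<close> do not interfere with the optimum. Firm J's problem
  separates in \<open>a\<close>, \<open>e\<close> and \<open>m\<close>, and its first-order condition in \<open>m\<close> reads \<open>\<gamma> = 1 / g'(m)\<close>. Only
  \<open>m\<close> remains free, subject to \<open>\<alpha> = K - G(m) \<ge> 0\<close>.
\<close>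

section \<open>Increasing concave functions with Inada conditions\<close>

text \<open>Collects what \<open>\<phi>\<close>, \<open>\<psi>\<close> and \<open>g\<close> share.
  Nonnegativity is left out because \<open>g\<close> may be negative near 0.\<close>

locale inada =
  fixes f :: "real \<Rightarrow> real"
  assumes C1: "C1_Rp f"
    and mono: "mono_on {0..} f"
    and strict_concave: "strictly_concave_on {0..} f"
    and deriv_0: "deriv_Rp f 0 = \<infinity>"
    and deriv_at_top: "(deriv_Rp f \<longlongrightarrow> 0) at_top"
begin

text \<open>At 0 the infinite derivative is sent to the default value 0, so facts about
  \<open>df\<close> are stated for positive arguments only.\<close>

definition df :: "real \<Rightarrow> real" where
  "df x = real_of_ereal (deriv_Rp f x)"

lemma deriv_Rp_eq: "x > 0 \<Longrightarrow> deriv_Rp f x = ereal (df x)"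
  using C1 unfolding C1_Rp_def df_def by (simp add: ereal_real')

lemma has_derivative:
  assumes "x > 0"
  shows "(f has_real_derivative df x) (at x)"
proof -
  have "((\<lambda>y. ereal ((f y - f x) / (y - x))) \<longlongrightarrow> ereal (df x)) (at x within {0..})"
    using C1 assms unfolding C1_Rp_def deriv_Rp_eq[OF assms, symmetric] by simp
  moreover have "at x within {0..} = at x"
    using assms by (intro at_within_interior) (simp add: interior_real_atLeast)
  ultimately show ?thesis
    by (simp add: has_field_derivative_iff)
qed

lemma continuous: "continuous_on {0..} f"
  using C1 unfolding C1_Rp_def by blast

lemma continuous_df: "continuous_on {0<..} df"
proof -
  have "continuous_on {0<..} (deriv_Rp f)"
    by (rule continuous_on_subset[of "{x. 0 \<le> x \<and> \<bar>deriv_Rp f x\<bar> \<noteq> \<infinity>}"])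
      (use C1 in \<open>auto simp: C1_Rp_def\<close>)
  then have "continuous_on {0<..} (real_of_ereal \<circ> deriv_Rp f)"
    by (subst (asm) continuous_on_iff_real) (auto simp: deriv_Rp_eq)
  then show ?thesis
    by (simp add: df_def[abs_def] o_def)
qed

lemma above_chord:
  assumes "x \<ge> 0" "y \<ge> 0" "x \<noteq> y" "0 < t" "t < 1"
  shows "(1 - t) * f x + t * f y < f ((1 - t) * x + t * y)"
  using strict_concave assms unfolding strictly_concave_on_def by auto

lemma concave: "concave_on {0..} f"
  unfolding concave_on_def
proof (rule convex_onI)
  fix t x y :: real
  assume "0 < t" "t < 1" "x \<in> {0..}" "y \<in> {0..}"
  then show "- f ((1 - t) *\<^sub>R x + t *\<^sub>R y) \<le> (1 - t) * - f x + t * - f y"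
    using above_chord[of x y t] by (cases "x = y") (auto simp: algebra_simps)
qed simp

lemma strict_mono:
  assumes "0 \<le> x" "x < y"
  shows "f x < f y"
proof -
  \<comment> \<open>\<open>y\<close> is the midpoint of \<open>x\<close> and
    \<open>2 * y - x\<close>. Were \<open>f x = f y\<close>, strict concavity would push
    \<open>f (2 * y - x)\<close> below \<open>f y\<close>, against monotonicity.\<close>
  have "f x \<le> f y" "f y \<le> f (2 * y - x)"
    using assms by (auto intro!: mono_onD[OF mono])
  moreover have "(f x + f (2 * y - x)) / 2 < f y"
    using above_chord[of x "2 * y - x" "1 / 2"] assms by (simp add: field_simps)
  ultimately show ?thesis
    by simp
qed

text \<open>Convexity of \<open>- f\<close> gives only the weak bound. It is applied at the midpoint
  \<open>z\<close>, where strict concavity puts \<open>f z\<close> above the mean of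
  \<open>f x\<close> and \<open>f y\<close>; this makes the bound at \<open>y\<close> strict. The
  point \<open>y = 0\<close> is included.\<close>

lemma below_tangent:
  assumes "x > 0" "y \<ge> 0" "y \<noteq> x"
  shows "f y < f x + df x * (y - x)"
proof -
  define z where "z = (x + y) / 2"
  have "((\<lambda>x. - f x) has_real_derivative - df x) (at x within {0..})"
    by (rule has_field_derivative_at_within[OF DERIV_minus[OF has_derivative[OF assms(1)]]])
  moreover have "convex_on {0..} (\<lambda>x. - f x)"
    using concave by (simp only: concave_on_def)
  moreover have "x \<in> interior {0..}" "z \<in> {0..}" "connected {0::real..}"
    using assms by (simp_all add: z_def interior_real_atLeast)
  ultimately have "- df x * (z - x) \<le> - f z - - f x"
    using convex_on_imp_above_tangent[of "{0..}" "\<lambda>x. - f x" x z "- df x"] by blast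
  moreover have "z - x = (y - x) / 2"
    by (simp add: z_def field_simps)
  ultimately have "f z \<le> f x + df x * (y - x) / 2"
    by simp
  moreover have "(1 - 1 / 2) * f x + 1 / 2 * f y < f ((1 - 1 / 2) * x + 1 / 2 * y)"
    using assms by (intro above_chord) auto
  then have "(f x + f y) / 2 < f z"
    by (simp add: z_def add_divide_distrib)
  ultimately have "(f x + f y) / 2 < f x + df x * (y - x) / 2"
    by (rule less_le_trans[rotated])
  then show ?thesis
    by (simp add: field_simps)
qed

lemma df_pos:
  assumes "x > 0"
  shows "df x > 0"
  using below_tangent[of x "x + 1"] strict_mono[of x "x + 1"] assms by simp

lemma df_strict_antimono:
  assumes "0 < x" "x < y"
  shows "df y < df x"
proof -
  have "df y * (y - x) < df x * (y - x)"
    using below_tangent[of x y] below_tangent[of y x] assms by (simp add: algebra_simps)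
  then show ?thesis
    using assms by simp
qed

section \<open>The derivative as a bijection, and its inverse\<close>

lemma inj_deriv: "inj_on (deriv_Rp f) {0..}"
proof (rule linorder_inj_onI)
  fix x y :: real
  assume "x < y" "x \<in> {0..}" "y \<in> {0..}"
  then show "deriv_Rp f x \<noteq> deriv_Rp f y"
    using df_strict_antimono[of x y] by (cases "x = 0") (auto simp: deriv_0 deriv_Rp_eq)
qed auto

lemma steep_chord:
  assumes "\<epsilon> > 0"
  obtains y where "0 < y" "y < \<epsilon>" "f y - f 0 > c * y"
proof -
  have "((\<lambda>y. ereal ((f y - f 0) / y)) \<longlongrightarrow> \<infinity>) (at 0 within {0..})"
    using C1 deriv_0 unfolding C1_Rp_def by (force dest: spec[of _ 0])
  then have "eventually (\<lambda>y. ereal c < ereal ((f y - f 0) / y)) (at 0 within {0..})"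
    unfolding tendsto_PInfty by blast
  then obtain d where d: "d > 0" "\<And>y. y \<ge> 0 \<Longrightarrow> y \<noteq> 0 \<Longrightarrow> \<bar>y\<bar> < d \<Longrightarrow> c < (f y - f 0) / y"
    unfolding eventually_at by (auto simp: dist_real_def)
  define y where "y = min d \<epsilon> / 2"
  have "0 < y" "y < \<epsilon>" "y < d"
    using d(1) assms by (auto simp: y_def)
  moreover from this have "f y - f 0 > c * y"
    using d(2)[of y] by (simp add: field_simps)
  ultimately show thesis
    using that by blast
qed

text \<open>\<open>C1_Rp\<close> asks for continuity of the derivative only where it is finite, so
  its growth near 0 has to be derived: the mean value theorem turns a steep chord from 0 into a
  steep tangent.\<close>

lemma df_near_0:
  assumes "\<epsilon> > 0"
  obtains x where "0 < x" "x < \<epsilon>" "c < df x"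
proof -
  obtain y where y: "0 < y" "y < \<epsilon>" "f y - f 0 > c * y"
    using steep_chord assms by blast
  have "\<exists>l z. 0 < z \<and> z < y \<and> (f has_real_derivative l) (at z) \<and> f y - f 0 = (y - 0) * l"
    using y has_derivative
    by (intro MVT continuous_on_subset[OF continuous])
      (auto simp: real_differentiable_def)
  then obtain l z where z: "0 < z" "z < y" "(f has_real_derivative l) (at z)" "f y - f 0 = y * l"
    by auto
  moreover have "l = df z"
    using z has_derivative DERIV_unique by blast
  ultimately show thesis
    using y that[of z] by (simp add: mult.commute)
qed

lemma df_at_top:
  assumes "c > 0"
  obtains y where "x < y" "0 < y" "df y < c"
proof -
  have "eventually (\<lambda>y. deriv_Rp f y < ereal c) at_top"
    using deriv_at_top assms by (intro order_tendstoD(2)) auto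
  then have "eventually (\<lambda>y. deriv_Rp f y < ereal c \<and> x < y \<and> 0 < y) at_top"
    by (intro eventually_conj eventually_gt_at_top)
  then obtain y where "deriv_Rp f y < ereal c" "x < y" "0 < y"
    using eventually_happens trivial_limit_at_top_linorder by blast
  then show thesis
    using that by (simp add: deriv_Rp_eq)
qed

text \<open>\<open>k = 0\<close> encodes the value infinity, attained at 0. A finite positive value
  is reached by the intermediate value theorem between a point near 0 and a distant one.\<close>

lemma deriv_surj:
  assumes "k \<ge> 0" "c > 0"
  obtains x where "x \<ge> 0" "deriv_Rp f x = ereal c / ereal k"
proof (cases "k = 0")
  case True
  then show ?thesis
    using assms that[of 0] by (simp add: deriv_0)
next
  case False
  then have "c / k > 0"
    using assms by simp
  obtain x where x: "0 < x" "c / k < df x"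
    using df_near_0[of 1] by auto
  obtain y where y: "x < y" "df y < c / k"
    using df_at_top \<open>c / k > 0\<close> by blast
  have "continuous_on {x..y} df"
    using x by (intro continuous_on_subset[OF continuous_df]) auto
  then obtain z where z: "x \<le> z" "df z = c / k"
    using IVT2'[of df y "c / k" x] x y by auto
  then have "deriv_Rp f z = ereal c / ereal k"
    using x False deriv_Rp_eq[of z] by simp
  then show ?thesis
    using that[of z] x z by simp
qed

text \<open>\<open>the_inv_into\<close> is meaningful only on the range of the derivative.
  Surjectivity places the quotient in that range, and injectivity then gives the
  equivalence.\<close>

lemma inv_deriv_eq:
  assumes "x \<ge> 0" "k \<ge> 0" "c > 0"
  shows "x = inv_deriv_Rp f (ereal c / ereal k) \<longleftrightarrow> deriv_Rp f x = ereal c / ereal k"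
proof -
  obtain z where z: "z \<ge> 0" "deriv_Rp f z = ereal c / ereal k"
    using deriv_surj assms by blast
  then have "inv_deriv_Rp f (ereal c / ereal k) = z"
    unfolding inv_deriv_Rp_def by (intro the_inv_into_f_eq[OF inj_deriv]) auto
  with z show ?thesis
    using inj_onD[OF inj_deriv, of x z] assms by auto
qed

lemma inv_deriv_nonneg:
  assumes "k \<ge> 0" "c > 0"
  shows "inv_deriv_Rp f (ereal c / ereal k) \<ge> 0"
proof -
  obtain z where z: "z \<ge> 0" "deriv_Rp f z = ereal c / ereal k"
    using deriv_surj assms by blast
  then show ?thesis
    unfolding inv_deriv_Rp_def by (subst the_inv_into_f_eq[OF inj_deriv]) auto
qed

text \<open>For \<open>k \<le> 0\<close> the objective decreases, its only maximiser is 0, and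
  clamping \<open>k\<close> makes the right-hand side infinite, which is the derivative at 0. For
  \<open>k > 0\<close> a steep chord excludes 0, and at an interior point the first-order condition
  suffices by the tangent bound.\<close>

lemma argmax_iff_deriv:
  assumes "c > 0" "x \<ge> 0"
  shows "(\<forall>y\<ge>0. k * f y - c * y \<le> k * f x - c * x) \<longleftrightarrow> deriv_Rp f x = ereal c / ereal (max k 0)"
proof (cases "k > 0")
  case False
  have "deriv_Rp f x = \<infinity> \<longleftrightarrow> x = 0"
    using assms deriv_0 deriv_Rp_eq[of x] by (cases "x = 0") auto
  moreover have "(\<forall>y\<ge>0. k * f y - c * y \<le> k * f x - c * x) \<longleftrightarrow> x = 0"
  proof
    assume "\<forall>y\<ge>0. k * f y - c * y \<le> k * f x - c * x"
    then have "k * f 0 - c * 0 \<le> k * f x - c * x"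
      by blast
    then have "k * f 0 \<le> k * f x - c * x"
      by simp
    moreover have "k * f x \<le> k * f 0"
      using False assms by (intro mult_left_mono_neg mono_onD[OF mono]) auto
    ultimately have "c * x \<le> 0"
      by linarith
    then show "x = 0"
      using assms by (simp add: mult_le_0_iff)
  next
    assume x: "x = 0"
    show "\<forall>y\<ge>0. k * f y - c * y \<le> k * f x - c * x"
    proof (intro allI impI)
      fix y :: real assume y: "y \<ge> 0"
      have "k * f y \<le> k * f 0"
        using False y by (intro mult_left_mono_neg mono_onD[OF mono]) auto
      moreover have "c * y \<ge> 0"
        using assms y by simp
      ultimately show "k * f y - c * y \<le> k * f x - c * x"
        using x by simp
    qed
  qed
  ultimately show ?thesis
    using False assms by (simp add: max_def)
next
  case k: True
  show ?thesis
  proof (cases "x = 0")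
    case True
    obtain y where y: "0 < y" "f y - f 0 > c / k * y"
      using steep_chord[of 1 "c / k"] by auto
    then have "k * f y - c * y > k * f 0"
      using k by (simp add: field_simps)
    then have "\<not> k * f y - c * y \<le> k * f x - c * x"
      using True by simp
    then have "\<not> (\<forall>y\<ge>0. k * f y - c * y \<le> k * f x - c * x)"
      using y(1) less_imp_le by blast
    then show ?thesis
      using True k by (simp add: deriv_0)
  next
    case False
    with assms have x: "x > 0" by simp
    have "(\<forall>y\<ge>0. k * f y - c * y \<le> k * f x - c * x) \<longleftrightarrow> k * df x = c"
    proof
      assume max: "\<forall>y\<ge>0. k * f y - c * y \<le> k * f x - c * x"
      have "((\<lambda>y. k * f y - c * y) has_real_derivative k * df x - c) (at x)"
        using has_derivative[OF x] by (auto intro!: derivative_eq_intros)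
      moreover have "\<forall>y. \<bar>x - y\<bar> < x \<longrightarrow> k * f y - c * y \<le> k * f x - c * x"
        using max by auto
      ultimately have "k * df x - c = 0"
        by (rule DERIV_local_max[OF _ x])
      then show "k * df x = c" by simp
    next
      assume c: "k * df x = c"
      show "\<forall>y\<ge>0. k * f y - c * y \<le> k * f x - c * x"
      proof (intro allI impI)
        fix y :: real assume "y \<ge> 0"
        then have "f y \<le> f x + df x * (y - x)"
          using below_tangent[OF x, of y] by (cases "y = x") auto
        then have "k * f y \<le> k * (f x + df x * (y - x))"
          using k by simp
        then show "k * f y - c * y \<le> k * f x - c * x"
          by (simp add: c[symmetric] algebra_simps)
      qed
    qed
    moreover have "ereal c / ereal (max k 0) = ereal (c / k)"
      using k by simp
    ultimately show ?thesis
      using k deriv_Rp_eq[OF x] by (simp add: eq_divide_eq mult.commute)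
  qed
qed

lemma argmax_iff:
  assumes "c > 0" "x \<ge> 0"
  shows "(\<forall>y\<ge>0. k * f y - c * y \<le> k * f x - c * x) \<longleftrightarrow>
           x = inv_deriv_Rp f (ereal c / ereal (max k 0))"
  using argmax_iff_deriv[OF assms] inv_deriv_eq[of x "max k 0" c] assms by simp

text \<open>Here the maximiser is given and the coefficient is sought, as for \<gamma> given
  \<open>m\<close>. A maximum at 0 forces \<open>k = 0\<close>, in agreement with 1 / infinity =
  0.\<close>

lemma argmax_iff_inverse_deriv:
  assumes "k \<ge> 0" "x \<ge> 0"
  shows "(\<forall>y\<ge>0. k * f y - y \<le> k * f x - x) \<longleftrightarrow> k = real_of_ereal (1 / deriv_Rp f x)"
proof -
  have "deriv_Rp f x = ereal 1 / ereal k \<longleftrightarrow> k = real_of_ereal (1 / deriv_Rp f x)"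
  proof (cases "x = 0")
    case True
    then show ?thesis
      using assms by (cases "k = 0") (simp_all add: deriv_0)
  next
    case False
    with assms have "x > 0" by simp
    with assms df_pos[OF this] show ?thesis
      by (cases "k = 0") (auto simp: deriv_Rp_eq field_simps one_ereal_def)
  qed
  then show ?thesis
    using argmax_iff_deriv[of 1 x k] assms by (simp add: max_absorb1)
qed

text \<open>\<open>value_at_infinity\<close> is a \<open>Lim\<close>, so convergence must be
  established first: by monotonicity the limit is the supremum, which may be infinite.\<close>

lemma le_value_at_infinity:
  assumes "x \<ge> 0"
  shows "ereal (f x) \<le> value_at_infinity f"
proof -
  define L where "L = (SUP x\<in>{0..}. ereal (f x))"
  have le: "ereal (f x) \<le> L" if "x \<ge> 0" for x
    using that unfolding L_def by (intro SUP_upper) auto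
  have "((\<lambda>x. ereal (f x)) \<longlongrightarrow> L) at_top"
  proof (rule order_tendstoI)
    fix a assume "a < L"
    then obtain x0 where x0: "x0 \<ge> 0" "a < ereal (f x0)"
      unfolding L_def less_SUP_iff by auto
    have "a < ereal (f x)" if "x \<ge> x0" for x
      using x0 that mono_onD[OF mono, of x0 x] by (auto intro: less_le_trans)
    then show "eventually (\<lambda>x. a < ereal (f x)) at_top"
      unfolding eventually_at_top_linorder by blast
  next
    fix a assume "L < a"
    then show "eventually (\<lambda>x. ereal (f x) < a) at_top"
      unfolding eventually_at_top_linorder using le le_less_trans by blast
  qed
  then have "value_at_infinity f = L"
    unfolding value_at_infinity_def by (intro tendsto_Lim) auto
  then show ?thesis
    using le assms by simp
qed

section \<open>The function G, the threshold m_0 and the inverse of G\<close>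

lemma G_fun_0: "G_fun f 0 = 0"
  by (simp add: G_fun_def deriv_0)

lemma G_fun_eq: "x > 0 \<Longrightarrow> G_fun f x = f x / df x - x"
  using df_pos[of x] by (simp add: G_fun_def deriv_Rp_eq)

text \<open>The tangent at \<open>y\<close> evaluated at \<open>x\<close>, divided by
  \<open>df y\<close>. The left side is nonnegative once \<open>f x \<ge> 0\<close>, which yields
  monotonicity, and for \<open>f x > 0\<close> it becomes arbitrarily large as \<open>df y\<close>
  tends to 0, which yields unboundedness.\<close>

lemma G_fun_diff_gt:
  assumes "0 < x" "x < y"
  shows "f x * (1 / df y - 1 / df x) < G_fun f y - G_fun f x"
proof -
  have "(f y - f x) / df y > y - x"
    using below_tangent[of y x] assms df_pos[of y] by (simp add: field_simps)
  then show ?thesis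
    using assms by (simp add: G_fun_eq diff_divide_distrib algebra_simps)
qed

end

text \<open>\<open>ex_pos\<close> expresses that m_0 is finite: the set in \<open>m_zero\<close> is
  nonempty, so the real \<open>Inf\<close> is a true infimum.\<close>

locale inada_eventually_pos = inada +
  assumes ex_pos: "\<exists>x>0. f x > 0"
begin

lemma m_zero_nonneg: "m_zero f \<ge> 0"
  unfolding m_zero_def using ex_pos by (intro cInf_greatest) auto

lemma pos_above_m_zero:
  assumes "m_zero f < x"
  shows "f x > 0"
proof -
  obtain m where "m > 0" "f m > 0" "m < x"
    using cInf_lessD[of "{m. m > 0 \<and> f m > 0}" x] ex_pos assms unfolding m_zero_def by auto
  then show ?thesis
    using strict_mono[of m x] by simp
qed

lemma nonpos_below_m_zero:
  assumes "0 < x" "x < m_zero f"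
  shows "f x \<le> 0"
proof (rule ccontr)
  assume "\<not> f x \<le> 0"
  then have "m_zero f \<le> x"
    using assms unfolding m_zero_def by (intro cInf_lower) (auto intro!: bdd_belowI[of _ 0])
  with assms show False by simp
qed

text \<open>The signs of \<open>f\<close> on the two sides and continuity force a zero. The
  assumption excludes \<open>m_zero f = 0\<close>, where \<open>f 0\<close> may be positive.\<close>

lemma m_zero_root:
  assumes "m_zero f > 0"
  shows "f (m_zero f) = 0"
proof -
  have "isCont f (m_zero f)"
    using has_derivative[OF assms] by (rule DERIV_isCont)
  then have lim: "(f \<longlongrightarrow> f (m_zero f)) (at (m_zero f))"
    by (simp add: isCont_def)
  have "f (m_zero f) \<ge> 0"
  proof (rule tendsto_lowerbound[of f _ "at_right (m_zero f)"])
    show "(f \<longlongrightarrow> f (m_zero f)) (at_right (m_zero f))"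
      using lim by (rule filterlim_mono) (auto simp: at_le)
    show "eventually (\<lambda>x. 0 \<le> f x) (at_right (m_zero f))"
      using eventually_at_right_less[of "m_zero f"]
      by eventually_elim (auto intro: less_imp_le pos_above_m_zero)
  qed auto
  moreover have "f (m_zero f) \<le> 0"
  proof (rule tendsto_upperbound[of f _ "at_left (m_zero f)"])
    show "(f \<longlongrightarrow> f (m_zero f)) (at_left (m_zero f))"
      using lim by (rule filterlim_mono) (auto simp: at_le)
    have "eventually (\<lambda>x. x \<in> {0<..<m_zero f}) (at_left (m_zero f))"
      using assms by (rule eventually_at_left_real)
    then show "eventually (\<lambda>x. f x \<le> 0) (at_left (m_zero f))"
      by eventually_elim (auto intro: nonpos_below_m_zero)
  qed auto
  ultimately show ?thesis by simp
qed

lemma nonneg_from_m_zero: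
  assumes "m_zero f \<le> x" "0 < x"
  shows "f x \<ge> 0"
  using pos_above_m_zero[of x] m_zero_root assms by (cases "x = m_zero f") auto

lemma G_fun_m_zero: "G_fun f (m_zero f) = - m_zero f"
  using m_zero_nonneg m_zero_root by (cases "m_zero f = 0") (auto simp: G_fun_0 G_fun_eq)

lemma G_fun_strict_mono:
  assumes "m_zero f \<le> x" "x < y"
  shows "G_fun f x < G_fun f y"
proof (cases "x = 0")
  case True
  \<comment> \<open>At 0 the value of G is the conventional 0, so the claim becomes
    \<open>df y * y < f y\<close>, the tangent bound at \<open>y\<close> evaluated at 0 together
    with this sign. The sign follows by continuity, as \<open>f\<close> is positive on all positive
    reals.\<close>
  have f0: "f 0 \<ge> 0"
  proof (rule ccontr)
    assume "\<not> f 0 \<ge> 0"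
    moreover have "(f \<longlongrightarrow> f 0) (at 0 within {0..})"
      using continuous by (simp add: continuous_on_def)
    ultimately have "eventually (\<lambda>x. f x < 0) (at 0 within {0..})"
      by (intro order_tendstoD(2)) auto
    then obtain d where d: "d > 0" "\<And>x. x \<ge> 0 \<Longrightarrow> x \<noteq> 0 \<Longrightarrow> \<bar>x\<bar> < d \<Longrightarrow> f x < 0"
      unfolding eventually_at by (auto simp: dist_real_def)
    then have "f (d / 2) < 0"
      by simp
    moreover have "f (d / 2) > 0"
      using d(1) True assms by (intro pos_above_m_zero) simp
    ultimately show False
      by simp
  qed
  have "f 0 < f y - df y * y"
    using below_tangent[of y 0] True assms by simp
  then have "df y * y < f y"
    using f0 by simp
  then show ?thesis
    using True assms df_pos[of y] by (simp add: G_fun_0 G_fun_eq field_simps)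
next
  case False
  then have x: "x > 0"
    using assms m_zero_nonneg by simp
  have "1 / df x \<le> 1 / df y"
    using df_strict_antimono[of x y] df_pos[of y] x assms by (simp add: frac_le)
  then have "0 \<le> f x * (1 / df y - 1 / df x)"
    using nonneg_from_m_zero[of x] x assms by simp
  then show ?thesis
    using G_fun_diff_gt[of x y] x assms by simp
qed

lemma G_fun_unbounded:
  obtains y where "m_zero f < y" "G_fun f y > K"
proof -
  define x where "x = m_zero f + 1"
  have x: "x > 0" "f x > 0" "m_zero f < x"
    using m_zero_nonneg pos_above_m_zero[of x] by (auto simp: x_def)
  \<comment> \<open>Chosen so that \<open>1 / df y > c\<close> makes the lower bound of
    \<open>G_fun_diff_gt\<close> exceed the distance from \<open>G_fun f x\<close> to
    \<open>K\<close>.\<close>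
  define c where "c = \<bar>K - G_fun f x\<bar> / f x + 1 / df x + 1"
  have "c > 0"
    using x df_pos[of x] by (simp add: c_def add_nonneg_pos)
  then obtain y where y: "x < y" "df y < 1 / c"
    using df_at_top[of "1 / c" x] by auto
  then have "c < 1 / df y"
    using df_pos[of y] x \<open>c > 0\<close> by (simp add: field_simps)
  then have "f x * (\<bar>K - G_fun f x\<bar> / f x) < f x * (1 / df y - 1 / df x)"
    using x by (intro mult_strict_left_mono) (auto simp: c_def)
  then have "\<bar>K - G_fun f x\<bar> < G_fun f y - G_fun f x"
    using G_fun_diff_gt[of x y] x y by simp
  then show thesis
    using that[of y] x y by simp
qed

text \<open>Supplies a positive left end for the intermediate value theorem. If
  \<open>m_zero f = 0\<close>, then \<open>f\<close> stays bounded near 0 while \<open>df\<close>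
  takes arbitrarily large values there, so \<open>f x / df x\<close> can be made small.\<close>

lemma G_fun_small:
  assumes "K > 0"
  obtains x where "m_zero f \<le> x" "0 < x" "G_fun f x \<le> K"
proof (cases "m_zero f = 0")
  case False
  then show ?thesis
    using that[of "m_zero f"] m_zero_nonneg assms by (simp add: G_fun_m_zero)
next
  case True
  define c where "c = (\<bar>f 1\<bar> + 1) / K"
  have c: "c > 0"
    using assms by (simp add: c_def)
  obtain x where x: "0 < x" "x < 1" "c < df x"
    using df_near_0[of 1] by auto
  have "f x \<le> \<bar>f 1\<bar> + 1"
    using strict_mono[of x 1] x by simp
  moreover have "0 \<le> f x"
    using pos_above_m_zero[of x] x True by simp
  ultimately have "f x / df x \<le> (\<bar>f 1\<bar> + 1) / c"
    using x c by (intro frac_le) auto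
  also have "\<dots> = K"
    using assms by (simp add: c_def)
  finally show ?thesis
    using that[of x] x True by (simp add: G_fun_eq)
qed

lemma G_inv_props:
  assumes "K > 0"
  shows "G_fun f (G_inv f K) = K" "m_zero f \<le> G_inv f K"
proof -
  have inj: "inj_on (G_fun f) {m_zero f..}"
  proof (rule linorder_inj_onI)
    fix x y assume "x < y" "x \<in> {m_zero f..}"
    then show "G_fun f x \<noteq> G_fun f y"
      using G_fun_strict_mono[of x y] by simp
  qed auto
  obtain x where x: "m_zero f \<le> x" "0 < x" "G_fun f x \<le> K"
    using G_fun_small assms by blast
  obtain y where y: "m_zero f < y" "G_fun f y > K"
    using G_fun_unbounded by blast
  have "x \<le> y"
    using G_fun_strict_mono[of y x] x y by (cases "x \<le> y") auto
  moreover have "continuous_on {x..y} (G_fun f)"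
  proof -
    have "continuous_on {x..y} f" "continuous_on {x..y} df"
      using x by (auto intro: continuous_on_subset[OF continuous] continuous_on_subset[OF continuous_df])
    moreover have "\<forall>z\<in>{x..y}. df z \<noteq> 0"
      using x less_imp_neq[OF df_pos] by (metis atLeastAtMost_iff less_le_trans)
    ultimately have "continuous_on {x..y} (\<lambda>z. f z / df z - z)"
      by (intro continuous_on_diff continuous_on_divide continuous_on_id)
    then show ?thesis
      using x by (simp add: G_fun_eq cong: continuous_on_cong_simp)
  qed
  ultimately obtain z where z: "x \<le> z" "G_fun f z = K"
    using IVT'[of "G_fun f" x K y] x y by auto
  then have "G_inv f K = z"
    unfolding G_inv_def using x by (intro the_inv_into_f_eq[OF inj]) auto
  then show "G_fun f (G_inv f K) = K" "m_zero f \<le> G_inv f K"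
    using z x by auto
qed

lemma G_inv_pos:
  assumes "K > 0"
  shows "G_inv f K > 0"
  using G_inv_props[OF assms] m_zero_nonneg G_fun_0 assms by (cases "G_inv f K = 0") auto

text \<open>G is known to increase only from \<open>m_zero f\<close> on. Below that point it is
  nonpositive, hence below \<open>K\<close>, and \<open>m\<close> lies below
  \<open>G_inv f K\<close>; so both sides hold and the interval of admissible \<open>m\<close>
  starts at 0.\<close>

lemma G_fun_le_iff:
  assumes "K > 0" "m \<ge> 0"
  shows "G_fun f m \<le> K \<longleftrightarrow> m \<le> G_inv f K"
proof (cases "m < m_zero f")
  case True
  have "G_fun f m \<le> 0"
  proof (cases "m = 0")
    case False
    then have "f m / df m \<le> 0"
      using True assms nonpos_below_m_zero[of m] df_pos[of m] by (simp add: divide_le_0_iff)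
    with False assms show ?thesis
      by (simp add: G_fun_eq)
  qed (simp add: G_fun_0)
  then show ?thesis
    using True assms G_inv_props(2)[OF assms(1)] by simp
next
  case False
  then show ?thesis
    using G_inv_props[OF assms(1)] G_fun_strict_mono[of m "G_inv f K"]
      G_fun_strict_mono[of "G_inv f K" m]
    by (cases m "G_inv f K" rule: linorder_cases) auto
qed

end

section \<open>Cumulant generating functions\<close>

lemma exp_gt_tangent:
  assumes "x \<noteq> 0"
  shows "1 + x < exp (x :: real)"
proof -
  have "exp x \<noteq> 1 + x"
    using ln_eq_minus_one[of "exp x"] assms by auto
  with exp_ge_add_one_self[of x] show ?thesis
    by linarith
qed

locale exp_moments = prob_space M for M :: "'w measure" +
  fixes \<mu> :: "'w \<Rightarrow> real"
  assumes integrable_exp: "\<And>t. integrable M (\<lambda>\<omega>. exp (t * \<mu> \<omega>))"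
    and non_constant: "\<not> (\<exists>c. AE \<omega> in M. \<mu> \<omega> = c)"
begin

definition cgf :: "real \<Rightarrow> real" where
  "cgf t = ln (expectation (\<lambda>\<omega>. exp (t * \<mu> \<omega>)))"

lemma expectation_exp: "expectation (\<lambda>\<omega>. exp (t * \<mu> \<omega>)) = exp (cgf t)"
proof -
  have "0 < expectation (\<lambda>\<omega>. exp (t * \<mu> \<omega>))"
    by (rule expectation_greater[OF integrable_exp]) simp
  then show ?thesis
    by (simp add: cgf_def)
qed

lemma integrable_exp_affine: "integrable M (\<lambda>\<omega>. exp (c + t * \<mu> \<omega>))"
  using integrable_exp[of t] by (simp add: exp_add)

lemma expectation_exp_affine: "expectation (\<lambda>\<omega>. exp (c + t * \<mu> \<omega>)) = exp (c + cgf t)"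
  by (simp add: exp_add expectation_exp)

lemma cgf_lower_bound:
  assumes "AE \<omega> in M. l \<le> \<mu> \<omega>" "t \<ge> 0"
  shows "t * l \<le> cgf t"
proof -
  have "exp (t * l) \<le> expectation (\<lambda>\<omega>. exp (t * \<mu> \<omega>))"
    using assms by (intro integral_ge_const integrable_exp) (auto elim!: eventually_mono intro: mult_left_mono)
  then show ?thesis
    by (simp add: expectation_exp)
qed

text \<open>After normalising both exponentials to expectation one, the strict inequality is
  Young's inequality integrated.\<close>

lemma cgf_strict_convex:
  assumes "x \<noteq> y" "0 < p" "0 < q" "p + q = 1"
  shows "cgf (p * x + q * y) < p * cgf x + q * cgf y"
proof -
  define a b where "a \<omega> = - cgf x + x * \<mu> \<omega>" and "b \<omega> = - cgf y + y * \<mu> \<omega>" for \<omega>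
  define c where "c \<omega> = p * a \<omega> + q * b \<omega>" for \<omega>
  define d where "d = - (p * cgf x + q * cgf y)"
  have c_eq: "c = (\<lambda>\<omega>. d + (p * x + q * y) * \<mu> \<omega>)"
    by (auto simp: c_def d_def a_def b_def algebra_simps)
  define h where "h \<omega> = p * exp (a \<omega>) + q * exp (b \<omega>) - exp (c \<omega>)" for \<omega>
  \<comment> \<open>After factoring out \<open>exp (c \<omega>)\<close>, the linear terms cancel
    because \<open>c\<close> is the weighted mean of \<open>a\<close> and \<open>b\<close>. What
    remains are gaps between \<open>exp\<close> and its tangent at 0.\<close>
  have h_eq: "h \<omega> = exp (c \<omega>) * (p * (exp (a \<omega> - c \<omega>) - (1 + (a \<omega> - c \<omega>)))
      + q * (exp (b \<omega> - c \<omega>) - (1 + (b \<omega> - c \<omega>))))" for \<omega>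
  proof -
    have "p * (a \<omega> - c \<omega>) + q * (b \<omega> - c \<omega>) = (1 - (p + q)) * c \<omega>"
      by (simp add: c_def algebra_simps)
    then have 0: "p * (1 + (a \<omega> - c \<omega>)) + q * (1 + (b \<omega> - c \<omega>)) = 1"
      using assms by (simp add: algebra_simps)
    have "exp (c \<omega>) * (p * (exp (a \<omega> - c \<omega>) - (1 + (a \<omega> - c \<omega>)))
        + q * (exp (b \<omega> - c \<omega>) - (1 + (b \<omega> - c \<omega>))))
      = p * (exp (c \<omega>) * exp (a \<omega> - c \<omega>)) + q * (exp (c \<omega>) * exp (b \<omega> - c \<omega>))
        - exp (c \<omega>) * (p * (1 + (a \<omega> - c \<omega>)) + q * (1 + (b \<omega> - c \<omega>)))"
      by (simp only: algebra_simps)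
    then show ?thesis
      unfolding 0 by (simp add: h_def flip: exp_add)
  qed
  have pos: "exp z - (1 + z) \<ge> 0" for z :: real
    using exp_ge_add_one_self[of z] by linarith
  have h_nonneg: "h \<omega> \<ge> 0" for \<omega>
    unfolding h_eq using pos assms by (intro mult_nonneg_nonneg add_nonneg_nonneg) auto
  have h_zero: "a \<omega> = b \<omega>" if "h \<omega> = 0" for \<omega>
  proof (rule ccontr)
    assume "a \<omega> \<noteq> b \<omega>"
    moreover have "a \<omega> - c \<omega> = q * (a \<omega> - b \<omega>)"
    proof -
      have "a \<omega> = (p + q) * a \<omega>"
        using assms by simp
      then show ?thesis
        by (simp add: c_def algebra_simps)
    qed
    ultimately have "exp (a \<omega> - c \<omega>) - (1 + (a \<omega> - c \<omega>)) > 0"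
      using exp_gt_tangent[of "a \<omega> - c \<omega>"] assms by simp
    then have "h \<omega> > 0"
      unfolding h_eq using pos assms by (intro mult_pos_pos add_pos_nonneg) auto
    with that show False by simp
  qed
  have int: "integrable M (\<lambda>\<omega>. exp (a \<omega>))" "integrable M (\<lambda>\<omega>. exp (b \<omega>))" "integrable M (\<lambda>\<omega>. exp (c \<omega>))"
    unfolding a_def b_def c_eq by (rule integrable_exp_affine)+
  then have int_h: "integrable M h"
    unfolding h_def by (intro Bochner_Integration.integrable_diff Bochner_Integration.integrable_add
        integrable_mult_right)
  have exp_h: "expectation h = 1 - exp (d + cgf (p * x + q * y))"
  proof -
    have "expectation h = p * expectation (\<lambda>\<omega>. exp (a \<omega>)) + q * expectation (\<lambda>\<omega>. exp (b \<omega>))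
        - expectation (\<lambda>\<omega>. exp (c \<omega>))"
      unfolding h_def using int by simp
    then show ?thesis
      unfolding a_def b_def c_eq expectation_exp_affine using assms by simp
  qed
  have "expectation h \<noteq> 0"
  proof
    assume "expectation h = 0"
    then have "AE \<omega> in M. h \<omega> = 0"
      using integral_nonneg_eq_0_iff_AE[OF int_h] h_nonneg by simp
    \<comment> \<open>Equality means \<open>a = b\<close> almost everywhere, an equation affine in
      \<mu> with slope \<open>x - y \<noteq> 0\<close>, which makes \<mu> constant.\<close>
    then have "AE \<omega> in M. \<mu> \<omega> = (cgf x - cgf y) / (x - y)"
      by eventually_elim (use h_zero assms in \<open>force simp: a_def b_def field_simps\<close>)
    then show False
      using non_constant by blast
  qed
  moreover have "expectation h \<ge> 0"
    using h_nonneg by (rule Bochner_Integration.integral_nonneg)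
  ultimately have "exp (d + cgf (p * x + q * y)) < 1"
    using exp_h by linarith
  then show ?thesis
    by (simp add: d_def)
qed

end

section \<open>The contract game\<close>

locale contract_game =
  exp_moments M \<mu> + phi: inada \<phi> + psi: inada \<psi> + g: inada_eventually_pos g
  for M :: "'w measure" and \<mu> :: "'w \<Rightarrow> real" and \<phi> \<psi> g :: "real \<Rightarrow> real" +
  fixes ba bm be :: "real \<Rightarrow> real" and u v D r \<delta> \<mu>low :: real
  assumes u: "u > 0" and v: "v > 0" and D: "D > 0" and r: "r \<ge> 0"
    and mu_lower: "AE \<omega> in M. \<mu>low \<le> \<mu> \<omega>"
    and psi_nonneg: "\<And>x. x \<ge> 0 \<Longrightarrow> \<psi> x \<ge> 0"
    and savings_lt: "value_at_infinity \<phi> + ereal (max \<delta> 0) * value_at_infinity \<psi> < ereal \<mu>low"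
begin

abbreviation J where "J \<equiv> payoff_J M \<mu> \<phi> \<psi> g v \<delta> D r"
abbreviation I where "I \<equiv> payoff_I M \<mu> \<phi> \<psi> g ba bm be u \<delta>"

definition \<beta>h where "\<beta>h = v / (u + v)"
definition eh where "eh = inv_deriv_Rp \<phi> (ereal ((u + v) / u))"
text \<open>For \<open>\<delta> \<le> 0\<close> the denominator vanishes, the quotient is infinite
  and \<open>ah\<close> is 0.\<close>

definition ah where "ah = inv_deriv_Rp \<psi> (ereal ((u + v) * (1 + r)) / ereal (max \<delta> 0 * u))"
definition K where
  "K = C_fun M \<mu> \<phi> v \<beta>h + (1 + r) * (D + ah) + eh - u / (u + v) * \<delta> * \<psi> ah"

definition savings where "savings a e = \<phi> e + \<delta> * \<psi> a"

text \<open>The smallest value of the transfer \<open>\<alpha> + \<gamma> g(m)\<close> for which firm J participates.\<close>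

definition reservation where
  "reservation \<beta> a e m =
     cgf (v * (1 - \<beta>)) / v - (1 - \<beta>) * savings a e + e + m + (1 + r) * (D + a)"

section \<open>Certainty equivalents and participation\<close>

lemma one_minus_beta: "1 - \<beta>h = u / (u + v)"
  using u v by (simp add: \<beta>h_def field_simps)

text \<open>Exponential utility lets deterministic amounts factor out of the expectation.
  Participation thus becomes a comparison of the transfer with \<open>reservation\<close>, and V(0)
  is the case of equality.\<close>

lemma payoff_J_eq: "J \<alpha> \<beta> \<gamma> a e m = - exp (- v * (\<alpha> + \<gamma> * g m - reservation \<beta> a e m))"
proof -
  define c where
    "c = - v * (\<alpha> + (1 - \<beta>) * savings a e - e + \<gamma> * g m - m - (1 + r) * (D + a))"
  have "exp_utility v (\<alpha> + (\<beta> - 1) * op_cost \<phi> \<psi> \<delta> a e x - e + \<gamma> * g m - m - (1 + r) * (D + a))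
      = - exp (c + v * (1 - \<beta>) * x)" for x
    by (simp add: exp_utility_def op_cost_def c_def savings_def algebra_simps)
  then have "J \<alpha> \<beta> \<gamma> a e m = - exp (c + cgf (v * (1 - \<beta>)))"
    unfolding payoff_J_def by (simp only: integral_minus expectation_exp_affine)
  also have "c + cgf (v * (1 - \<beta>)) = - v * (\<alpha> + \<gamma> * g m - reservation \<beta> a e m)"
    using v by (simp add: c_def reservation_def algebra_simps)
  finally show ?thesis .
qed

lemma payoff_I_eq:
  "I \<alpha> \<beta> \<gamma> a e m =
     ba a - exp (u * (\<alpha> + \<gamma> * g m - \<beta> * savings a e + cgf (u * \<beta>) / u - bm m - be e))"
proof -
  define c where "c = u * (\<alpha> + \<gamma> * g m - \<beta> * savings a e - bm m - be e)"
  have "ba a + exp_utility u (bm m + be e - \<alpha> - \<beta> * op_cost \<phi> \<psi> \<delta> a e x - \<gamma> * g m)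
      = ba a - exp (c + u * \<beta> * x)" for x
    by (simp add: exp_utility_def op_cost_def c_def savings_def algebra_simps)
  then have "I \<alpha> \<beta> \<gamma> a e m = expectation (\<lambda>\<omega>. ba a - exp (c + u * \<beta> * \<mu> \<omega>))"
    unfolding payoff_I_def by simp
  also have "\<dots> = ba a - exp (c + cgf (u * \<beta>))"
    by (simp add: integrable_exp_affine expectation_exp_affine prob_space)
  also have "c + cgf (u * \<beta>)
      = u * (\<alpha> + \<gamma> * g m - \<beta> * savings a e + cgf (u * \<beta>) / u - bm m - be e)"
    using u by (simp add: c_def algebra_simps)
  finally show ?thesis .
qed

lemma participation_iff:
  "exp_utility v 0 \<le> J \<alpha> \<beta> \<gamma> a e m \<longleftrightarrow> reservation \<beta> a e m \<le> \<alpha> + \<gamma> * g m"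
  using v by (simp add: payoff_J_eq exp_utility_def zero_le_mult_iff)

lemma payoff_I_le_iff:
  "I \<alpha>' \<beta>' \<gamma>' a e m \<le> I \<alpha> \<beta> \<gamma> a e m \<longleftrightarrow>
     \<alpha> + \<gamma> * g m - \<beta> * savings a e + cgf (u * \<beta>) / u
       \<le> \<alpha>' + \<gamma>' * g m - \<beta>' * savings a e + cgf (u * \<beta>') / u"
  using u by (auto simp: payoff_I_eq)

text \<open>Since \<psi> is nonnegative, \<delta> may be replaced by its positive part. The limits
  at infinity could be infinite, so the comparison is made in the extended reals.\<close>

lemma savings_less:
  assumes "a \<ge> 0" "e \<ge> 0"
  shows "savings a e < \<mu>low"
proof -
  have "ereal (max \<delta> 0) * ereal (\<psi> a) \<le> ereal (max \<delta> 0) * value_at_infinity \<psi>"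
    using psi.le_value_at_infinity[OF assms(1)]
    by (intro ereal_mult_left_mono) (simp_all only: zero_ereal_def ereal_less_eq max.cobounded2)
  then have "ereal (\<phi> e) + ereal (max \<delta> 0) * ereal (\<psi> a)
      \<le> value_at_infinity \<phi> + ereal (max \<delta> 0) * value_at_infinity \<psi>"
    using phi.le_value_at_infinity[OF assms(2)] by (intro add_mono)
  also note savings_lt
  finally have "\<phi> e + max \<delta> 0 * \<psi> a < \<mu>low"
    by (simp only: times_ereal.simps plus_ereal.simps less_ereal.simps)
  moreover have "\<delta> * \<psi> a \<le> max \<delta> 0 * \<psi> a"
    using psi_nonneg[OF assms(1)] by (intro mult_right_mono) auto
  ultimately show ?thesis
    by (simp add: savings_def)
qed

text \<open>For \<open>\<beta> \<le> 1\<close> firm J bears a nonnegative share of an operating cost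
  that is positive almost surely, and the debt term with \<open>D > 0\<close> makes the bound
  strict.\<close>

lemma reservation_pos:
  assumes "a \<ge> 0" "e \<ge> 0" "m \<ge> 0" "\<beta> \<le> 1"
  shows "reservation \<beta> a e m > 0"
proof -
  have "v * (1 - \<beta>) * savings a e \<le> v * (1 - \<beta>) * \<mu>low"
    using savings_less[OF assms(1,2)] v assms by (intro mult_left_mono) auto
  also have "\<dots> \<le> cgf (v * (1 - \<beta>))"
    using v assms by (intro cgf_lower_bound mu_lower) auto
  finally have "(1 - \<beta>) * savings a e \<le> cgf (v * (1 - \<beta>)) / v"
    using v by (simp add: field_simps)
  moreover have "(1 + r) * (D + a) > 0"
    using D r assms by (intro mult_pos_pos) auto
  ultimately show ?thesis
    using assms by (simp add: reservation_def)
qed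

text \<open>Efficient risk sharing equalises the two risk exposures \<open>u \<beta>\<close> and \<open>v (1 - \<beta>)\<close>.\<close>

lemma risk_sharing:
  assumes "\<beta> \<noteq> \<beta>h"
  shows "cgf (u * \<beta>h) / u + cgf (v * (1 - \<beta>h)) / v < cgf (u * \<beta>) / u + cgf (v * (1 - \<beta>)) / v"
proof -
  \<comment> \<open>With these weights the mean of \<open>u * \<beta>\<close> and
    \<open>v * (1 - \<beta>)\<close> is \<open>u * v / (u + v)\<close> for every \<beta>, the common
    exposure at \<open>\<beta>h\<close>. Scaling by \<open>(u + v) / (u * v)\<close> then turns the
    weights into \<open>1 / u\<close> and \<open>1 / v\<close>.\<close>
  define p q where "p = v / (u + v)" and "q = u / (u + v)"
  have pq: "p > 0" "q > 0" "p + q = 1"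
    using u v by (simp_all add: p_def q_def flip: add_divide_distrib)
  have "u * \<beta> \<noteq> v * (1 - \<beta>)"
    using assms u v by (auto simp: \<beta>h_def field_simps)
  then have "cgf (p * (u * \<beta>) + q * (v * (1 - \<beta>))) < p * cgf (u * \<beta>) + q * cgf (v * (1 - \<beta>))"
    using pq by (intro cgf_strict_convex)
  also have "p * (u * \<beta>) + q * (v * (1 - \<beta>)) = (v * (u * \<beta>) + u * (v * (1 - \<beta>))) / (u + v)"
    by (simp add: p_def q_def add_divide_distrib)
  also have "v * (u * \<beta>) + u * (v * (1 - \<beta>)) = u * v"
    by (simp add: algebra_simps)
  finally have "(u + v) / (u * v) * cgf (u * v / (u + v))
      < (u + v) / (u * v) * (p * cgf (u * \<beta>) + q * cgf (v * (1 - \<beta>)))"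
    using u v by (intro mult_strict_left_mono) auto
  also have "\<dots> = ((u + v) / (u * v) * p) * cgf (u * \<beta>) + ((u + v) / (u * v) * q) * cgf (v * (1 - \<beta>))"
    by (simp only: distrib_left mult.assoc)
  also have "(u + v) / (u * v) * p = 1 / u"
    using u v by (simp add: p_def)
  also have "(u + v) / (u * v) * q = 1 / v"
    using u v by (simp add: q_def)
  also have "(u + v) / (u * v) * cgf (u * v / (u + v)) = cgf (u * \<beta>h) / u + cgf (v * (1 - \<beta>h)) / v"
  proof -
    have "(u + v) / (u * v) = 1 / u + 1 / v"
      using u v by (simp add: field_simps)
    then show ?thesis
      unfolding one_minus_beta by (simp add: \<beta>h_def distrib_right mult.commute)
  qed
  finally show ?thesis
    by simp
qed

text \<open>Firm I's payoff depends on \<alpha> and \<gamma> only through the transfer and decreases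
  in it, so participation binds and only \<beta> is left to optimise. How the transfer splits into
  \<alpha> and \<gamma> stays undetermined.\<close>

lemma best_response_I_iff:
  assumes "a \<ge> 0" "e \<ge> 0" "m \<ge> 0"
  shows "(0 \<le> \<alpha> \<and> 0 \<le> \<gamma> \<and> exp_utility v 0 \<le> J \<alpha> \<beta> \<gamma> a e m \<and>
      (\<forall>\<alpha>'\<ge>0. \<forall>\<beta>'. \<forall>\<gamma>'\<ge>0. exp_utility v 0 \<le> J \<alpha>' \<beta>' \<gamma>' a e m \<longrightarrow>
         I \<alpha>' \<beta>' \<gamma>' a e m \<le> I \<alpha> \<beta> \<gamma> a e m))
    \<longleftrightarrow> 0 \<le> \<alpha> \<and> 0 \<le> \<gamma> \<and> \<beta> = \<beta>h \<and> \<alpha> + \<gamma> * g m = reservation \<beta>h a e m"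
proof -
  define cost where "cost s \<beta> = s - \<beta> * savings a e + cgf (u * \<beta>) / u" for s \<beta>
  have I_le: "I \<alpha>' \<beta>' \<gamma>' a e m \<le> I \<alpha> \<beta> \<gamma> a e m \<longleftrightarrow>
      cost (\<alpha> + \<gamma> * g m) \<beta> \<le> cost (\<alpha>' + \<gamma>' * g m) \<beta>'" for \<alpha>' \<beta>' \<gamma>' \<alpha> \<beta> \<gamma>
    unfolding payoff_I_le_iff cost_def ..
  \<comment> \<open>With a binding transfer the savings enter with total weight
    \<open>(1 - \<beta>) + \<beta> = 1\<close>, so only the two \<open>cgf\<close> terms depend on
    \<beta>.\<close>
  have cost_binding: "cost (reservation \<beta>h a e m) \<beta>h < cost (reservation \<beta> a e m) \<beta>" if "\<beta> \<noteq> \<beta>h" for \<beta>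
    using risk_sharing[OF that] by (simp add: cost_def reservation_def algebra_simps)
  have cost_mono: "cost s \<beta> \<le> cost t \<beta> \<longleftrightarrow> s \<le> t" for s t \<beta>
    by (simp add: cost_def)
  have le: "cost (reservation \<beta>h a e m) \<beta>h \<le> cost s \<beta>" if "reservation \<beta> a e m \<le> s" for s \<beta>
    using cost_binding[of \<beta>] cost_mono[of "reservation \<beta> a e m" \<beta> s] that
    by (cases "\<beta> = \<beta>h") auto
  have "\<beta>h \<le> 1"
    using u v by (simp add: \<beta>h_def)
  then have pos: "reservation \<beta>h a e m \<ge> 0"
    using reservation_pos[OF assms] by (simp add: less_imp_le)
  show ?thesis (is "?L \<longleftrightarrow> ?R")
  proof
    assume L: ?L
    then have part: "reservation \<beta> a e m \<le> \<alpha> + \<gamma> * g m"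
      by (simp add: participation_iff)
    \<comment> \<open>The competing contract pays the whole transfer through \<alpha>; it is
      admissible because the reservation transfer is nonnegative.\<close>
    have "exp_utility v 0 \<le> J (reservation \<beta>h a e m) \<beta>h 0 a e m"
      by (simp add: participation_iff)
    then have "I (reservation \<beta>h a e m) \<beta>h 0 a e m \<le> I \<alpha> \<beta> \<gamma> a e m"
      using L pos by blast
    then have opt: "cost (\<alpha> + \<gamma> * g m) \<beta> \<le> cost (reservation \<beta>h a e m) \<beta>h"
      by (simp add: I_le)
    have "\<beta> = \<beta>h"
    proof (rule ccontr)
      assume "\<beta> \<noteq> \<beta>h"
      from cost_binding[OF this] opt cost_mono[of "reservation \<beta> a e m" \<beta> "\<alpha> + \<gamma> * g m"] part
      show False
        by linarith
    qed
    then show ?R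
      using L opt part cost_mono by auto
  next
    assume R: ?R
    then have "exp_utility v 0 \<le> J \<alpha> \<beta> \<gamma> a e m"
      by (simp add: participation_iff)
    moreover have "I \<alpha>' \<beta>' \<gamma>' a e m \<le> I \<alpha> \<beta> \<gamma> a e m"
      if "exp_utility v 0 \<le> J \<alpha>' \<beta>' \<gamma>' a e m" for \<alpha>' \<beta>' \<gamma>'
      using that R le by (simp add: participation_iff I_le)
    ultimately show ?L
      using R by blast
  qed
qed

section \<open>Best response of firm J\<close>

lemma eh_alt: "inv_deriv_Rp \<phi> (ereal 1 / ereal (max (u / (u + v)) 0)) = eh"
  using u v by (simp add: eh_def max_absorb1)

text \<open>\<open>argmax_iff\<close> clamps the scaled coefficient, whereas \<open>ah\<close>
  clamps \<delta> itself; for \<open>\<delta> \<le> 0\<close> both quotients are infinite.\<close>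

lemma ah_alt: "inv_deriv_Rp \<psi> (ereal (1 + r) / ereal (max (u / (u + v) * \<delta>) 0)) = ah"
proof (cases "\<delta> > 0")
  case True
  then have "max (u / (u + v) * \<delta>) 0 = u / (u + v) * \<delta>" "max \<delta> 0 = \<delta>"
    using u v by (simp_all add: max_absorb1)
  then show ?thesis
    using True u v unfolding ah_def by (simp add: mult.commute)
next
  case False
  then have "max (u / (u + v) * \<delta>) 0 = 0" "max \<delta> 0 = 0"
    using u v by (simp_all add: max_absorb2 mult_nonneg_nonpos divide_nonpos_pos)
  then show ?thesis
    using u v r unfolding ah_def by simp
qed

lemma eh_nonneg: "eh \<ge> 0"
  using phi.inv_deriv_nonneg[of "max (u / (u + v)) 0" 1] unfolding eh_alt by simp

lemma ah_nonneg: "ah \<ge> 0"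
  using psi.inv_deriv_nonneg[of "max (u / (u + v) * \<delta>) 0" "1 + r"] r unfolding ah_alt by simp

text \<open>With \<beta> fixed the certainty equivalent is, up to a constant, a sum of functions of
  \<open>a\<close>, \<open>e\<close> and \<open>m\<close>. Varying one coordinate at a time reduces
  the joint maximum to three scalar problems.\<close>

lemma best_response_J_iff:
  assumes "a \<ge> 0" "e \<ge> 0" "m \<ge> 0" "\<gamma> \<ge> 0"
  shows "(\<forall>a'\<ge>0. \<forall>e'\<ge>0. \<forall>m'\<ge>0. J \<alpha> \<beta>h \<gamma> a' e' m' \<le> J \<alpha> \<beta>h \<gamma> a e m) \<longleftrightarrow>
    a = ah \<and> e = eh \<and> \<gamma> = real_of_ereal (1 / deriv_Rp g m)"
proof -
  define A where "A a = u / (u + v) * \<delta> * \<psi> a - (1 + r) * a" for a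
  define E where "E e = u / (u + v) * \<phi> e - 1 * e" for e
  define N where "N m = \<gamma> * g m - m" for m
  have exp_le: "- exp (- v * x) \<le> - exp (- v * y) \<longleftrightarrow> x \<le> y" for x y
    using v by simp
  have "J \<alpha> \<beta>h \<gamma> a' e' m' \<le> J \<alpha> \<beta>h \<gamma> a e m \<longleftrightarrow>
      \<gamma> * g m' - reservation \<beta>h a' e' m' \<le> \<gamma> * g m - reservation \<beta>h a e m" for a' e' m'
    unfolding payoff_J_eq exp_le by auto
  also have "\<dots> a' e' m' \<longleftrightarrow> A a' + E e' + N m' \<le> A a + E e + N m" for a' e' m'
    unfolding reservation_def one_minus_beta savings_def A_def E_def N_def
    by (simp add: algebra_simps)
  finally have "(\<forall>a'\<ge>0. \<forall>e'\<ge>0. \<forall>m'\<ge>0. J \<alpha> \<beta>h \<gamma> a' e' m' \<le> J \<alpha> \<beta>h \<gamma> a e m) \<longleftrightarrow>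
      (\<forall>a'\<ge>0. \<forall>e'\<ge>0. \<forall>m'\<ge>0. A a' + E e' + N m' \<le> A a + E e + N m)"
    by simp
  also have "\<dots> \<longleftrightarrow> (\<forall>a'\<ge>0. A a' \<le> A a) \<and> (\<forall>e'\<ge>0. E e' \<le> E e) \<and> (\<forall>m'\<ge>0. N m' \<le> N m)"
    (is "?joint \<longleftrightarrow> ?separate")
  proof
    assume joint: ?joint
    show ?separate
    proof (intro conjI allI impI)
      fix x :: real assume x: "x \<ge> 0"
      show "A x \<le> A a" "E x \<le> E e" "N x \<le> N m"
        using joint[rule_format, OF x assms(2,3)] joint[rule_format, OF assms(1) x assms(3)]
          joint[rule_format, OF assms(1,2) x] by simp_all
    qed
  qed (auto intro!: add_mono)
  also have "(\<forall>a'\<ge>0. A a' \<le> A a) \<longleftrightarrow> a = ah"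
    unfolding A_def using psi.argmax_iff[of "1 + r" a "u / (u + v) * \<delta>"] r assms
    by (simp only: ah_alt)
  also have "(\<forall>e'\<ge>0. E e' \<le> E e) \<longleftrightarrow> e = eh"
    unfolding E_def using phi.argmax_iff[of 1 e "u / (u + v)"] assms
    by (simp only: eh_alt)
  also have "(\<forall>m'\<ge>0. N m' \<le> N m) \<longleftrightarrow> \<gamma> = real_of_ereal (1 / deriv_Rp g m)"
    unfolding N_def using g.argmax_iff_inverse_deriv[of \<gamma> m] assms by simp
  finally show ?thesis .
qed

lemma inverse_deriv_g_nonneg:
  assumes "m \<ge> 0"
  shows "real_of_ereal (1 / deriv_Rp g m) \<ge> 0"
  using assms g.deriv_0 g.deriv_Rp_eq[of m] g.df_pos[of m] by (cases "m = 0") (auto simp: one_ereal_def)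

section \<open>The constant K, the equilibria and their payoffs\<close>

lemma e_star_eq: "e_star \<phi> \<beta>h = eh"
  using eh_alt unfolding e_star_def one_minus_beta by (simp add: one_ereal_def)

lemma C_fun_eq: "C_fun M \<mu> \<phi> v \<beta>h = cgf (v * (1 - \<beta>h)) / v - (1 - \<beta>h) * \<phi> eh"
proof -
  have "v * (1 - \<beta>h) * (x - \<phi> eh) = - (v * (1 - \<beta>h) * \<phi> eh) + v * (1 - \<beta>h) * x" for x
    by (simp add: algebra_simps)
  then show ?thesis
    unfolding C_fun_def e_star_eq using v
    by (simp only: expectation_exp_affine ln_exp) (simp add: field_simps)
qed

text \<open>Identifies \<open>K\<close> as the reservation transfer at \<open>m = 0\<close>, which
  also yields its positivity.\<close>

lemma reservation_eq: "reservation \<beta>h ah eh m = K + m"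
  unfolding reservation_def K_def C_fun_eq one_minus_beta savings_def
  by (simp add: algebra_simps)

lemma K_pos: "K > 0"
proof -
  have "\<beta>h \<le> 1"
    using u v by (simp add: \<beta>h_def)
  from reservation_pos[OF ah_nonneg eh_nonneg order_refl this] show ?thesis
    by (simp add: reservation_eq)
qed

text \<open>For \<gamma> = 1 / g'(m) this is \<gamma> g(m) - m, so the binding transfer
  \<open>K + m\<close> leaves \<alpha> = K - G(m).\<close>

lemma G_fun_alt: "G_fun g m = real_of_ereal (1 / deriv_Rp g m) * g m - m"
  by (simp add: G_fun_def divide_ereal_def mult.commute)

lemma nash_nonneg:
  assumes "nash M \<mu> \<phi> \<psi> g ba bm be u v \<delta> D r \<alpha> \<beta> \<gamma> e m a"
  shows "a \<ge> 0" "e \<ge> 0" "m \<ge> 0"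
  using assms unfolding nash_def Let_def by - (elim conjE, assumption)+

text \<open>Firm I's best response fixes \<open>\<beta> = \<beta>h\<close>, after which firm J's
  characterisation applies. The sign of \<gamma> comes with its formula, and
  \<open>\<alpha> \<ge> 0\<close> becomes the upper bound on \<open>m\<close>.\<close>

lemma nash_iff:
  "nash M \<mu> \<phi> \<psi> g ba bm be u v \<delta> D r \<alpha> \<beta> \<gamma> e m a \<longleftrightarrow>
     \<beta> = \<beta>h \<and> e = eh \<and> a = ah \<and> \<gamma> = real_of_ereal (1 / deriv_Rp g m) \<and>
     \<alpha> = K - G_fun g m \<and> m \<in> {0..G_inv g K}"
proof (cases "0 \<le> a \<and> 0 \<le> e \<and> 0 \<le> m")
  case True
  then have nonneg: "0 \<le> a" "0 \<le> e" "0 \<le> m"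
    by auto
  define opt_J where
    "opt_J \<longleftrightarrow> (\<forall>a'\<ge>0. \<forall>e'\<ge>0. \<forall>m'\<ge>0. J \<alpha> \<beta> \<gamma> a' e' m' \<le> J \<alpha> \<beta> \<gamma> a e m)"
  have opt_J_iff: "opt_J \<longleftrightarrow> a = ah \<and> e = eh \<and> \<gamma> = real_of_ereal (1 / deriv_Rp g m)"
    if "\<beta> = \<beta>h" "0 \<le> \<gamma>"
    unfolding opt_J_def that(1) using nonneg that(2) by (rule best_response_J_iff)
  have "nash M \<mu> \<phi> \<psi> g ba bm be u v \<delta> D r \<alpha> \<beta> \<gamma> e m a \<longleftrightarrow>
      opt_J \<and> 0 \<le> \<alpha> \<and> 0 \<le> \<gamma> \<and> \<beta> = \<beta>h \<and> \<alpha> + \<gamma> * g m = reservation \<beta>h a e m"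
    unfolding nash_def Let_def best_response_I_iff[OF nonneg] opt_J_def[symmetric]
    by (simp only: nonneg simp_thms)
  also have "\<dots> \<longleftrightarrow> \<beta> = \<beta>h \<and> e = eh \<and> a = ah \<and> \<gamma> = real_of_ereal (1 / deriv_Rp g m) \<and>
      0 \<le> \<alpha> \<and> \<alpha> + \<gamma> * g m = K + m"
    using opt_J_iff inverse_deriv_g_nonneg[OF nonneg(3)] reservation_eq by auto
  also have "\<dots> \<longleftrightarrow> \<beta> = \<beta>h \<and> e = eh \<and> a = ah \<and> \<gamma> = real_of_ereal (1 / deriv_Rp g m) \<and>
      \<alpha> = K - G_fun g m \<and> G_fun g m \<le> K"
    unfolding G_fun_alt by auto
  also have "G_fun g m \<le> K \<longleftrightarrow> m \<in> {0..G_inv g K}"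
    using nonneg g.G_fun_le_iff[OF K_pos, of m] by simp
  finally show ?thesis .
next
  case False
  then show ?thesis
    using nash_nonneg eh_nonneg ah_nonneg by auto
qed

text \<open>The parametrisation \<open>F\<close> is injective because \<open>m\<close> is one of its
  components, and its domain is a nondegenerate interval.\<close>

lemma infinite_nash: "infinite {(\<alpha>, \<beta>, \<gamma>, e, m, a). nash M \<mu> \<phi> \<psi> g ba bm be u v \<delta> D r \<alpha> \<beta> \<gamma> e m a}"
proof -
  define F where "F m = (K - G_fun g m, \<beta>h, real_of_ereal (1 / deriv_Rp g m), eh, m, ah)" for m
  have "infinite (F ` {0..G_inv g K})"
    using g.G_inv_pos[OF K_pos] by (subst finite_image_iff) (auto simp: inj_on_def F_def)
  moreover have "F ` {0..G_inv g K} \<subseteq> {(\<alpha>, \<beta>, \<gamma>, e, m, a). nash M \<mu> \<phi> \<psi> g ba bm be u v \<delta> D r \<alpha> \<beta> \<gamma> e m a}"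
    by (auto simp: F_def nash_iff)
  ultimately show ?thesis
    by (meson finite_subset)
qed

lemma nash_payoffs:
  assumes "nash M \<mu> \<phi> \<psi> g ba bm be u v \<delta> D r \<alpha> \<beta> \<gamma> e m a"
  shows "J \<alpha> \<beta> \<gamma> a e m = exp_utility v 0"
    and "I \<alpha> \<beta> \<gamma> a e m = ba ah - exp (- u * \<delta> * \<psi> ah) * exp (u * (1 + r) * (D + ah)) *
                       B_fun M \<mu> \<phi> bm be u v m"
proof -
  from assms have eq: "\<beta> = \<beta>h" "e = eh" "a = ah"
    and s: "\<alpha> + \<gamma> * g m = K + m"
    by (simp_all add: nash_iff G_fun_alt)
  show "J \<alpha> \<beta> \<gamma> a e m = exp_utility v 0"
    by (simp add: payoff_J_eq eq s reservation_eq exp_utility_def)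
  \<comment> \<open>At \<open>\<beta>h\<close> both firms have the same exposure, so firm I's
    \<open>cgf\<close> term can be expressed through \<open>C_fun\<close>, which is defined from
    firm J's side.\<close>
  have w: "u * \<beta>h = v * (1 - \<beta>h)"
    unfolding one_minus_beta by (simp add: \<beta>h_def)
  have cgf_eq: "cgf (u * \<beta>h) = v * C_fun M \<mu> \<phi> v \<beta>h + u * \<beta>h * \<phi> eh"
    using v unfolding C_fun_eq w by (simp add: algebra_simps)
  have K_eq: "K = C_fun M \<mu> \<phi> v \<beta>h + (1 + r) * (D + ah) + eh - (1 - \<beta>h) * \<delta> * \<psi> ah"
    by (simp add: K_def one_minus_beta)
  have "u * (K + m - \<beta>h * savings ah eh + cgf (u * \<beta>h) / u - bm m - be eh)
      = u * (K + m) - u * \<beta>h * savings ah eh + cgf (u * \<beta>h) - u * bm m - u * be eh"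
    using u by (simp add: algebra_simps)
  also have "\<dots> = - u * \<delta> * \<psi> ah + u * (1 + r) * (D + ah)
      + (u * (m - bm m) + u * (eh - be eh) + (u + v) * C_fun M \<mu> \<phi> v \<beta>h)"
    unfolding cgf_eq K_eq savings_def by (simp add: algebra_simps)
  finally show "I \<alpha> \<beta> \<gamma> a e m = ba ah - exp (- u * \<delta> * \<psi> ah) * exp (u * (1 + r) * (D + ah)) *
                       B_fun M \<mu> \<phi> bm be u v m"
    unfolding payoff_I_eq eq s B_fun_def by (simp only: exp_add e_star_eq flip: \<beta>h_def)
qed

end

theorem theorem1:
  fixes M :: "'w measure" and \<mu> :: "'w \<Rightarrow> real" and \<mu>low :: real
    and \<phi> \<psi> g ba bm be :: "real \<Rightarrow> real"
    and u v D r \<delta> :: real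
  assumes "u > 0" "v > 0" "D > 0" "r \<ge> 0"
    and "prob_space M" "\<mu> \<in> borel_measurable M"
    and "\<not> (\<exists>c. AE \<omega> in M. \<mu> \<omega> = c)"
    and "AE \<omega> in M. \<mu>low \<le> \<mu> \<omega>"
    and "\<And>t::real. integrable M (\<lambda>\<omega>. exp (t * \<mu> \<omega>))"
    and "\<And>x. x \<ge> 0 \<Longrightarrow> \<phi> x \<ge> 0" "C1_Rp \<phi>" "mono_on {0..} \<phi>" "strictly_concave_on {0..} \<phi>"
    and "deriv_Rp \<phi> 0 = \<infinity>" "(deriv_Rp \<phi> \<longlongrightarrow> 0) at_top"
    and "\<And>x. x \<ge> 0 \<Longrightarrow> \<psi> x \<ge> 0" "C1_Rp \<psi>" "mono_on {0..} \<psi>" "strictly_concave_on {0..} \<psi>"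
    and "deriv_Rp \<psi> 0 = \<infinity>" "(deriv_Rp \<psi> \<longlongrightarrow> 0) at_top"
    and "value_at_infinity \<phi> + ereal (max \<delta> 0) * value_at_infinity \<psi> < ereal \<mu>low"
    and "(\<lambda>x. inv_deriv_Rp \<phi> (ereal x)) \<sim>[at_right 0] (\<lambda>x. inv_deriv_Rp \<psi> (ereal x))"
    and "C1_Rp g" "mono_on {0..} g" "strictly_concave_on {0..} g"
    and "deriv_Rp g 0 = \<infinity>" "(deriv_Rp g \<longlongrightarrow> 0) at_top"
    and "\<exists>m>0. g m > 0"
    and "\<And>x. x \<ge> 0 \<Longrightarrow> ba x \<ge> 0" "C1_Rp ba" "mono_on {0..} ba" "concave_on {0..} ba"
    and "deriv_Rp ba 0 > 0" "(deriv_Rp ba \<longlongrightarrow> 0) at_top" "value_at_infinity ba < \<infinity>"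
    and "\<And>x. x \<ge> 0 \<Longrightarrow> bm x \<ge> 0" "C1_Rp bm" "mono_on {0..} bm" "concave_on {0..} bm"
    and "deriv_Rp bm 0 = \<infinity>" "(deriv_Rp bm \<longlongrightarrow> 0) at_top"
    and "\<And>x. x \<ge> 0 \<Longrightarrow> be x \<ge> 0" "C1_Rp be" "mono_on {0..} be" "concave_on {0..} be"
    and "deriv_Rp be 0 = \<infinity>" "(deriv_Rp be \<longlongrightarrow> 0) at_top"
  shows
    "let NE = nash M \<mu> \<phi> \<psi> g ba bm be u v \<delta> D r;
         \<beta>h = v / (u + v);
         eh = inv_deriv_Rp \<phi> (ereal ((u + v) / u));
         ah = inv_deriv_Rp \<psi> (ereal ((u + v) * (1 + r)) / ereal (max \<delta> 0 * u));
         K = C_fun M \<mu> \<phi> v \<beta>h + (1 + r) * (D + ah) + eh - u / (u + v) * \<delta> * \<psi> ah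
     in infinite {(\<alpha>, \<beta>, \<gamma>, e, m, a). NE \<alpha> \<beta> \<gamma> e m a} \<and>
        (\<forall>\<alpha> \<beta> \<gamma> e m a. NE \<alpha> \<beta> \<gamma> e m a \<longleftrightarrow>
           \<beta> = \<beta>h \<and> e = eh \<and> a = ah \<and>
           \<gamma> = real_of_ereal (1 / deriv_Rp g m) \<and>
           \<alpha> = K - G_fun g m \<and>
           m \<in> {0..G_inv g K}) \<and>
        (\<forall>\<alpha> \<beta> \<gamma> e m a. NE \<alpha> \<beta> \<gamma> e m a \<longrightarrow>
           payoff_J M \<mu> \<phi> \<psi> g v \<delta> D r \<alpha> \<beta> \<gamma> a e m = exp_utility v 0 \<and>
           payoff_I M \<mu> \<phi> \<psi> g ba bm be u \<delta> \<alpha> \<beta> \<gamma> a e m =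
             ba ah - exp (- u * \<delta> * \<psi> ah) * exp (u * (1 + r) * (D + ah)) *
                       B_fun M \<mu> \<phi> bm be u v m)"
proof -
  interpret exp_moments M \<mu>
    using assms by (intro exp_moments.intro exp_moments_axioms.intro)
  interpret phi: inada \<phi>
    using assms by (intro inada.intro)
  interpret psi: inada \<psi>
    using assms by (intro inada.intro)
  interpret g: inada_eventually_pos g
    using assms by (intro inada_eventually_pos.intro inada.intro inada_eventually_pos_axioms.intro)
  interpret contract_game M \<mu> \<phi> \<psi> g ba bm be u v D r \<delta> \<mu>low
    by unfold_locales (fact assms)+
  show ?thesis
    unfolding Let_def \<beta>h_def[symmetric] eh_def[symmetric] ah_def[symmetric]
    unfolding K_def[symmetric]
    using infinite_nash nash_iff nash_payoffs by blast
qed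

end
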